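(* Let $\mathcal C\subseteq 2^{[n]}$ be an intersection complete code, and let $d=\dim(\Delta(\mathcal C))$, i.e. one less than the largest size of a codeword of $\mathcal C$. Then $\operatorname{cdim}(\mathcal C)\le\min\{2d+1,n-1\}$.
   Context: A code is a set $\mathcal C\subseteq 2^{[n]}$ of subsets of $[n]$; by convention every code contains $\emptyset$. It is intersection complete if the intersection of any two codewords is a codeword. $\Delta(\mathcal C)$ is the smallest subset-closed family containing $\mathcal C$, and its dimension is one less than the size of its largest member. For $\mathcal U=\{U_1,\dots,U_n\}$ subsets of $\mathbb R^d$, $U_\sigma=\bigcap_{i\in\sigma}U_i$ ($U_\emptyset=\mathbb R^d$) and $\operatorname{code}(\mathcal U)=\{\sigma\subseteq[n] : U_\sigma\setminus\bigcup_{j\notin\sigma}U_j\neq\emptyset\}$. $\operatorname{cdim}(\mathcal C)$ is the least $d$ such that $\mathcal C=\operatorname{code}(\mathcal U)$ for some collection of (possibly empty) closed convex sets in $\mathbb R^d$, or $\infty$ if none exists.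
   Formalization: Assumes n ≥ 2 and C ≠ {∅}; the claim fails exactly in the excluded cases: for C = {∅} the bound is −1 while cdim is at least 0, and for n = 1, C = {∅,{1}} the bound is 0 but a single point realizes only one codeword, so cdim = 1. *)

theory Defs
  imports "HOL-Analysis.Analysis"
begin

text \<open>The neurons are \<open>[n] = {1..n}\<close>.\<close>

definition is_code :: "nat \<Rightarrow> nat set set \<Rightarrow> bool" where
  "is_code n C \<longleftrightarrow> C \<subseteq> Pow {1..n} \<and> {} \<in> C"

definition intersection_complete :: "nat set set \<Rightarrow> bool" where
  "intersection_complete C \<longleftrightarrow> (\<forall>\<sigma>\<in>C. \<forall>\<tau>\<in>C. \<sigma> \<inter> \<tau> \<in> C)"

definition subset_closed :: "nat set set \<Rightarrow> bool" where
  "subset_closed K \<longleftrightarrow> (\<forall>\<sigma>\<in>K. \<forall>\<tau>. \<tau> \<subseteq> \<sigma> \<longrightarrow> \<tau> \<in> K)"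

definition simplicial_complex_of :: "nat set set \<Rightarrow> nat set set" where
  "simplicial_complex_of C = \<Inter> {K. C \<subseteq> K \<and> subset_closed K}"

text \<open>Integer-valued, so that the complex \<open>{{}}\<close> has dimension \<open>-1\<close>. Meaningful
  for nonempty finite families of finite sets.\<close>

definition complex_dim :: "nat set set \<Rightarrow> int" where
  "complex_dim K = int (Max (card ` K)) - 1"

text \<open>The space \<open>\<real>\<^sup>d\<close> is \<^const>\<open>Euclidean_space\<close> \<open>d\<close>, whose points are the sequences vanishing
  at all indices \<open>\<ge> d\<close>. The function type is not an instance of \<^class>\<open>real_vector\<close>, so
  \<^const>\<open>convex\<close> is restated coordinatewise.\<close>

definition convex_seq :: "(nat \<Rightarrow> real) set \<Rightarrow> bool" where
  "convex_seq S \<longleftrightarrow>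
    (\<forall>x\<in>S. \<forall>y\<in>S. \<forall>u\<ge>0. \<forall>v\<ge>0. u + v = 1 \<longrightarrow> (\<lambda>k. u * x k + v * y k) \<in> S)"

text \<open>Intersecting with the ambient space gives \<open>U\<^sub>\<emptyset> = \<real>\<^sup>d\<close>.\<close>

definition cap_of :: "nat \<Rightarrow> (nat \<Rightarrow> (nat \<Rightarrow> real) set) \<Rightarrow> nat set \<Rightarrow> (nat \<Rightarrow> real) set" where
  "cap_of d U \<sigma> = topspace (Euclidean_space d) \<inter> (\<Inter>i\<in>\<sigma>. U i)"

definition code_of :: "nat \<Rightarrow> nat \<Rightarrow> (nat \<Rightarrow> (nat \<Rightarrow> real) set) \<Rightarrow> nat set set" where
  "code_of n d U = {\<sigma>. \<sigma> \<subseteq> {1..n} \<and> cap_of d U \<sigma> - (\<Union>j\<in>{1..n} - \<sigma>. U j) \<noteq> {}}"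

definition closed_convex_realizable :: "nat \<Rightarrow> nat set set \<Rightarrow> nat \<Rightarrow> bool" where
  "closed_convex_realizable n C d \<longleftrightarrow>
    (\<exists>U. (\<forall>i\<in>{1..n}. closedin (Euclidean_space d) (U i) \<and> convex_seq (U i)) \<and>
         C = code_of n d U)"

text \<open>The infimum of the empty set in \<^typ>\<open>enat\<close> is \<open>\<infinity>\<close>.\<close>

definition cdim :: "nat \<Rightarrow> nat set set \<Rightarrow> enat" where
  "cdim n C = Inf (enat ` {d. closed_convex_realizable n C d})"

end

theory Submission
  imports Defs "HOL-Computational_Algebra.Polynomial"
begin

text \<open>Let \<open>f\<^sub>1, \<dots>, f\<^sub>n\<close> be affine functions on \<open>\<real>\<^sup>D\<close>, and for every nonempty codeword \<open>c\<close>
  let \<open>P\<^sub>c\<close> be a point at which the functions attaining the minimum of \<open>f\<^sub>1, \<dots>, f\<^sub>n\<close> are exactly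
  those with index in \<open>c\<close>. Let \<open>U\<^sub>i\<close> be the convex hull of the points \<open>P\<^sub>c\<close> with \<open>i \<in> c\<close>. If
  \<open>x \<in> U\<^sub>i\<close> is a combination of such points, then the functions attaining the minimum at \<open>x\<close> are
  those with index in the intersection of the codewords that carry positive weight. Hence
  \<open>x \<in> U\<^sub>j\<close> iff \<open>j\<close> lies in this intersection, which is a codeword.

  In dimension \<open>n - 1\<close> take the coordinate functions and the zero function. In dimension
  \<open>2 d + 1\<close> identify points with monic polynomials of degree \<open>2 d + 2\<close> modulo constants, let
  \<open>f\<^sub>i\<close> be evaluation at \<open>i\<close>, and let \<open>P\<^sub>c\<close> be a polynomial that is nonnegative on \<open>{1..n}\<close> and
  vanishes there exactly at the elements of \<open>c\<close>. Constants may be discarded because they do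
  not affect which \<open>f\<^sub>i\<close> are minimal; this saves one dimension.\<close>

section \<open>Convex hulls of finite families of points\<close>

text \<open>Forcing \<open>l\<close> to vanish off \<open>S\<close> confines the weights to a
  compact product, and lets one \<open>l\<close> serve as weights on several index sets.\<close>

definition weights :: "'a set \<Rightarrow> ('a \<Rightarrow> real) set" where
  "weights S = {l. (\<forall>c. 0 \<le> l c) \<and> (\<forall>c. c \<notin> S \<longrightarrow> l c = 0) \<and> sum l S = 1}"

definition hull_points :: "('a \<Rightarrow> nat \<Rightarrow> real) \<Rightarrow> 'a set \<Rightarrow> (nat \<Rightarrow> real) set" where
  "hull_points P S = (\<lambda>l k. \<Sum>c\<in>S. l c * P c k) ` weights S"

lemma hull_pointsI:
  assumes "l \<in> weights S" "x = (\<lambda>k. \<Sum>c\<in>S. l c * P c k)"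
  shows "x \<in> hull_points P S"
  using assms by (auto simp: hull_points_def)

text \<open>By Tychonoff: a closed slice of a product of copies of \<open>{0..1}\<close> and
  \<open>{0}\<close>.\<close>

lemma compact_weights:
  assumes "finite S"
  shows "compact (weights S)"
proof -
  define B where "B = PiE UNIV (\<lambda>c. if c \<in> S then {0..1::real} else {0})"
  have "compactin (product_topology (\<lambda>_. euclideanreal) UNIV) B"
    unfolding B_def compactin_PiE by auto
  then have B: "compact B"
    by (simp add: euclidean_product_topology)
  have cont: "continuous_on UNIV (\<lambda>l::'a \<Rightarrow> real. sum l S)"
    by (intro continuous_on_sum continuous_on_product_coordinates)
  have "closed ((\<lambda>l::'a \<Rightarrow> real. sum l S) -` {1})"
    by (rule closed_vimage[OF closed_singleton cont])
  then have "compact (B \<inter> (\<lambda>l. sum l S) -` {1})"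
    by (rule compact_Int_closed[OF B])
  moreover have "weights S = B \<inter> (\<lambda>l. sum l S) -` {1}"
  proof (intro equalityI subsetI)
    fix l assume l: "l \<in> weights S"
    have "l c \<le> 1" if "c \<in> S" for c
      using member_le_sum[of c S l] l that assms by (auto simp: weights_def)
    then show "l \<in> B \<inter> (\<lambda>l. sum l S) -` {1}"
      using l by (auto simp: weights_def B_def PiE_def)
  next
    fix l assume l: "l \<in> B \<inter> (\<lambda>l. sum l S) -` {1}"
    then have *: "l c \<in> (if c \<in> S then {0..1} else {0})" for c
      by (auto simp: B_def PiE_iff)
    have "0 \<le> l c" "c \<notin> S \<longrightarrow> l c = 0" for c
      using *[of c] by (auto split: if_splits)
    then show "l \<in> weights S"
      using l by (auto simp: weights_def)
  qed
  ultimately show ?thesis by simp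
qed

lemma compact_hull_points:
  assumes "finite S"
  shows "compact (hull_points P S)"
  unfolding hull_points_def
  by (intro compact_continuous_image compact_weights assms continuous_on_coordinatewise_then_product
      continuous_on_sum continuous_on_mult continuous_on_const
      continuous_on_subset[OF continuous_on_product_coordinates]) auto

lemma convex_seq_hull_points: "convex_seq (hull_points P S)"
  unfolding convex_seq_def
proof (intro ballI allI impI)
  fix x y and u v :: real
  assume "x \<in> hull_points P S" "y \<in> hull_points P S" and uv: "0 \<le> u" "0 \<le> v" "u + v = 1"
  then obtain l m where l: "l \<in> weights S" "x = (\<lambda>k. \<Sum>c\<in>S. l c * P c k)"
    and m: "m \<in> weights S" "y = (\<lambda>k. \<Sum>c\<in>S. m c * P c k)"
    by (auto simp: hull_points_def)
  have "(\<lambda>c. u * l c + v * m c) \<in> weights S"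
    using l m uv by (auto simp: weights_def sum.distrib simp flip: sum_distrib_left)
  moreover have "(\<lambda>k. u * x k + v * y k) = (\<lambda>k. \<Sum>c\<in>S. (u * l c + v * m c) * P c k)"
    by (auto simp: l m sum_distrib_left sum.distrib algebra_simps)
  ultimately show "(\<lambda>k. u * x k + v * y k) \<in> hull_points P S"
    by (rule hull_pointsI)
qed

lemma point_in_hull_points:
  assumes "finite S" "c \<in> S"
  shows "P c \<in> hull_points P S"
proof -
  define l where "l = (\<lambda>c'. if c' = c then 1 else 0::real)"
  have "l \<in> weights S"
    using assms by (auto simp: weights_def l_def)
  moreover have "P c = (\<lambda>k. \<Sum>c'\<in>S. l c' * P c' k)"
    using assms by (auto simp: l_def if_distrib[of "\<lambda>x. x * _"] cong: if_cong)
  ultimately show ?thesis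
    by (rule hull_pointsI)
qed

section \<open>Codes realized by minimizers of affine functions\<close>

lemma topspace_Euclidean_space_iff:
  "x \<in> topspace (Euclidean_space D) \<longleftrightarrow> (\<forall>k\<ge>D. x k = 0)"
  by (auto simp: topspace_Euclidean_space)

lemma intersection_complete_Inter:
  assumes "intersection_complete C" "finite T" "T \<noteq> {}" "T \<subseteq> C"
  shows "\<Inter>T \<in> C"
  using assms(2-4)
  by (induction rule: finite_ne_induct) (use assms(1) in \<open>auto simp: intersection_complete_def\<close>)

text \<open>By \<open>eq\<close> and \<open>less\<close>, the functions minimal at
  \<open>P c\<close> are exactly those indexed by a nonempty \<open>c\<close>. Positivity of
  \<open>D\<close> leaves room for a point outside all hulls, which realizes the empty
  codeword.\<close>

lemma closed_convex_realizable_of_minimizers: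
  fixes a :: "nat \<Rightarrow> nat \<Rightarrow> real" and b :: "nat \<Rightarrow> real" and P :: "nat set \<Rightarrow> nat \<Rightarrow> real"
    and D :: nat
  defines "f \<equiv> \<lambda>i x. b i + (\<Sum>k<D. a i k * x k)"
  assumes code: "is_code n C" and ic: "intersection_complete C" and D: "0 < D"
    and P0: "\<And>c k. c \<in> C \<Longrightarrow> D \<le> k \<Longrightarrow> P c k = 0"
    and eq: "\<And>c i j. c \<in> C \<Longrightarrow> i \<in> c \<Longrightarrow> j \<in> c \<Longrightarrow> f i (P c) = f j (P c)"
    and less: "\<And>c i j. c \<in> C \<Longrightarrow> i \<in> c \<Longrightarrow> j \<in> {1..n} \<Longrightarrow> j \<notin> c \<Longrightarrow> f i (P c) < f j (P c)"
  shows "closed_convex_realizable n C D"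
proof -
  have C: "C \<subseteq> Pow {1..n}" "{} \<in> C"
    using code by (auto simp: is_code_def)
  then have finC: "finite C"
    by (meson finite_Pow_iff finite_atLeastAtMost finite_subset)
  define St where "St i = {c\<in>C. i \<in> c}" for i
  have finSt: "finite (St i)" for i
    using finC by (simp add: St_def)
  define U where "U i = hull_points P (St i)" for i
  have top: "U i \<subseteq> topspace (Euclidean_space D)" for i
    using P0 by (auto simp: U_def hull_points_def topspace_Euclidean_space_iff St_def)
  have closedU: "closedin (Euclidean_space D) (U i)" for i
  proof -
    have "closedin euclidean (U i)"
      using compact_imp_closed[OF compact_hull_points[OF finSt]] by (simp add: U_def)
    then show ?thesis
      unfolding Euclidean_space_def euclidean_product_topology[symmetric] closedin_subtopology
      using top[of i] by (auto simp: topspace_Euclidean_space_iff intro!: exI[of _ "U i"])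
  qed
  have f_comb: "f i (\<lambda>k. \<Sum>c\<in>S. l c * P c k) = (\<Sum>c\<in>S. l c * f i (P c))"
    if "l \<in> weights S" for i l S
  proof -
    have "(\<Sum>c\<in>S. l c * f i (P c)) = b i * sum l S + (\<Sum>c\<in>S. \<Sum>k<D. a i k * (l c * P c k))"
      by (simp add: f_def algebra_simps sum.distrib sum_distrib_left)
    also have "\<dots> = b i + (\<Sum>k<D. a i k * (\<Sum>c\<in>S. l c * P c k))"
      using that by (subst sum.swap) (simp add: weights_def sum_distrib_left)
    finally show ?thesis by (simp add: f_def)
  qed
  \<comment> \<open>The witness is \<open>\<Inter>T\<close>, with \<open>T\<close> the codewords of
    positive weight. The equivalences close in a circle: \<open>T_U\<close> leads from
    \<open>j \<in> \<Inter>T\<close> to \<open>x \<in> U j\<close>, \<open>U_T\<close> on to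
    \<open>f j x \<le> f i x\<close>, and \<open>notin_T\<close> back.\<close>
  have key: "\<exists>c\<in>C. \<forall>j\<in>{1..n}. (j \<in> c \<longleftrightarrow> x \<in> U j) \<and> (j \<in> c \<longleftrightarrow> f j x \<le> f i x)"
    if x: "x \<in> U i" and i: "i \<in> {1..n}" for i x
  proof -
    obtain l where l: "l \<in> weights (St i)" and x_eq: "x = (\<lambda>k. \<Sum>c\<in>St i. l c * P c k)"
      using x by (auto simp: U_def hull_points_def)
    define T where "T = {c \<in> St i. l c \<noteq> 0}"
    have l0: "0 \<le> l c" for c
      using l by (simp add: weights_def)
    have "T \<noteq> {}"
    proof
      assume "T = {}"
      then have "sum l (St i) = 0"
        by (intro sum.neutral) (auto simp: T_def)
      then show False using l by (simp add: weights_def)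
    qed
    then have IC: "\<Inter>T \<in> C"
      by (intro intersection_complete_Inter[OF ic]) (use finC in \<open>auto simp: T_def St_def\<close>)
    have fx: "f j x = (\<Sum>c\<in>St i. l c * f j (P c))" for j
      unfolding x_eq by (rule f_comb[OF l])
    have le: "f i (P c) \<le> f j (P c)" if "c \<in> St i" "j \<in> {1..n}" for c j
      using that eq[of c i j] less[of c i j] by (cases "j \<in> c") (auto simp: St_def)
    have in_T: "f j x \<le> f i x" if "j \<in> \<Inter>T" for j
    proof -
      have same: "l c * f j (P c) = l c * f i (P c)" if "c \<in> St i" for c
        using that \<open>j \<in> \<Inter>T\<close> eq[of c j i] by (cases "l c = 0") (auto simp: T_def St_def)
      then show ?thesis unfolding fx by (intro sum_mono eq_refl same)
    qed
    \<comment> \<open>Some codeword of positive weight omits \<open>j\<close> and contributes a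
      strict inequality; all others contribute weak ones.\<close>
    have notin_T: "f i x < f j x" if j: "j \<in> {1..n}" "j \<notin> \<Inter>T" for j
    proof -
      obtain c where c: "c \<in> T" "j \<notin> c" using j by auto
      have "l c * f i (P c) < l c * f j (P c)"
        using c l0[of c] less[of c i j] j by (auto simp: T_def St_def)
      then show ?thesis
        unfolding fx using c le[OF _ j(1)] l0
        by (intro sum_strict_mono_ex1 finSt) (auto simp: T_def mult_left_mono)
    qed
    \<comment> \<open>Every codeword of positive weight contains \<open>j\<close>, so the same
      \<open>l\<close> represents \<open>x\<close> over \<open>St j\<close>.\<close>
    have T_U: "x \<in> U j" if j: "j \<in> \<Inter>T" for j
    proof -
      have zero: "l c = 0" if "c \<notin> St i \<inter> St j" for c
        using that j l by (auto simp: T_def St_def weights_def)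
      have restrict: "(\<Sum>c\<in>St j. l c * g c) = (\<Sum>c\<in>St i. l c * g c)" for g
      proof -
        have "(\<Sum>c\<in>St j. l c * g c) = (\<Sum>c\<in>St i \<inter> St j. l c * g c)"
          by (rule sum.mono_neutral_right) (use zero finSt in auto)
        also have "\<dots> = (\<Sum>c\<in>St i. l c * g c)"
          by (rule sum.mono_neutral_left) (use zero finSt in auto)
        finally show ?thesis .
      qed
      have "l \<in> weights (St j)"
        using l zero restrict[of "\<lambda>_. 1"] by (auto simp: weights_def)
      then show ?thesis
        unfolding U_def by (rule hull_pointsI) (simp add: x_eq restrict)
    qed
    \<comment> \<open>Here \<open>x\<close> has its own representation \<open>m\<close> over
      \<open>St j\<close>, at all of whose points \<open>f j\<close> is minimal.\<close>
    have U_T: "f j x \<le> f i x" if j: "x \<in> U j" "j \<in> {1..n}" for j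
    proof -
      obtain m where m: "m \<in> weights (St j)" and x_eq': "x = (\<lambda>k. \<Sum>c\<in>St j. m c * P c k)"
        using j by (auto simp: U_def hull_points_def)
      have "f j (P c) \<le> f i (P c)" if "c \<in> St j" for c
        using that eq[of c i j] less[of c j i] i by (cases "i \<in> c") (auto simp: St_def)
      then show ?thesis
        unfolding x_eq' f_comb[OF m] using m
        by (intro sum_mono mult_left_mono) (auto simp: weights_def)
    qed
    show ?thesis
      using IC in_T notin_T T_U U_T by (metis not_le)
  qed
  have "C = code_of n D U"
  proof (intro equalityI subsetI)
    fix c assume c: "c \<in> C"
    then have cn: "c \<subseteq> {1..n}" using C by auto
    have "\<exists>x. x \<in> cap_of D U c \<and> (\<forall>j\<in>{1..n} - c. x \<notin> U j)"
    proof (cases "c = {}")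
      case True
      \<comment> \<open>\<open>B\<close> bounds the coordinate 0 of every \<open>P c\<close>, hence
        of every hull, so a point with coordinate \<open>B + 1\<close> avoids them all.\<close>
      define B where "B = (\<Sum>c\<in>C. \<bar>P c 0\<bar>)"
      define x where "x = (\<lambda>k::nat. if k = 0 then B + 1 else 0)"
      have "x \<notin> U j" for j
      proof
        assume "x \<in> U j"
        then obtain l where l: "l \<in> weights (St j)" "x = (\<lambda>k. \<Sum>c\<in>St j. l c * P c k)"
          by (auto simp: U_def hull_points_def)
        have "\<bar>P c 0\<bar> \<le> B" if "c \<in> C" for c
          unfolding B_def using that finC by (intro member_le_sum) auto
        then have "P c 0 \<le> B" if "c \<in> C" for c
          using that by (meson abs_le_D1)
        then have "(\<Sum>c\<in>St j. l c * P c 0) \<le> (\<Sum>c\<in>St j. l c * B)"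
          using l by (intro sum_mono mult_left_mono) (auto simp: weights_def St_def)
        also have "\<dots> = B"
          using l by (simp add: weights_def flip: sum_distrib_right)
        finally show False
          using fun_cong[OF l(2), of 0] by (simp add: x_def)
      qed
      moreover have "x \<in> topspace (Euclidean_space D)"
        using D by (simp add: topspace_Euclidean_space_iff x_def)
      ultimately show ?thesis
        using True by (auto simp: cap_of_def)
    next
      case False
      then obtain i where i: "i \<in> c" by auto
      have mem: "P c \<in> U j" if "j \<in> c" for j
        unfolding U_def using that c by (intro point_in_hull_points finSt) (simp add: St_def)
      have "P c \<notin> U j" if j: "j \<in> {1..n} - c" for j
      proof
        assume "P c \<in> U j"
        moreover have "i \<in> {1..n}" using i cn by auto
        ultimately have "f j (P c) \<le> f i (P c)"
          using key[OF mem[OF i]] j by blast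
        then show False
          using less[OF c i] j by fastforce
      qed
      moreover have "P c \<in> cap_of D U c"
        using mem top[of i] i by (auto simp: cap_of_def)
      ultimately show ?thesis by blast
    qed
    then show "c \<in> code_of n D U"
      using cn by (auto simp: code_of_def)
  next
    fix \<sigma> assume "\<sigma> \<in> code_of n D U"
    then obtain x where \<sigma>: "\<sigma> \<subseteq> {1..n}" and "x \<in> cap_of D U \<sigma> - (\<Union>j\<in>{1..n} - \<sigma>. U j)"
      by (auto simp only: code_of_def mem_Collect_eq ex_in_conv[symmetric])
    then have x: "\<And>i. i \<in> \<sigma> \<Longrightarrow> x \<in> U i" and nx: "\<And>j. j \<in> {1..n} - \<sigma> \<Longrightarrow> x \<notin> U j"
      by (auto simp: cap_of_def)
    show "\<sigma> \<in> C"
    proof (cases "\<sigma> = {}")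
      case False
      then obtain i where i: "i \<in> \<sigma>" by auto
      then obtain c where c: "c \<in> C" "\<forall>j\<in>{1..n}. j \<in> c \<longleftrightarrow> x \<in> U j"
        using key[of x i] x[OF i] \<sigma> by blast
      have "c = \<sigma>"
        using c C(1) x nx \<sigma> by blast
      then show ?thesis using c by simp
    qed (use C in simp)
  qed
  moreover have "convex_seq (U i)" for i
    unfolding U_def by (rule convex_seq_hull_points)
  ultimately show ?thesis
    unfolding closed_convex_realizable_def using closedU by (intro exI[of _ U]) simp
qed

section \<open>Realizations in the two dimensions\<close>

text \<open>Coordinate \<open>k\<close> belongs to neuron \<open>Suc k\<close>, and neuron
  \<open>n\<close> gets the zero function. \<open>P c\<close> is the indicator of the complement of
  \<open>c\<close>, shifted by a constant to vanish at \<open>n\<close>.\<close>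

lemma closed_convex_realizable_pred:
  assumes "2 \<le> n" "is_code n C" "intersection_complete C"
  shows "closed_convex_realizable n C (n - 1)"
proof -
  define P where "P c k = (if k < n - 1 then of_bool (Suc k \<notin> c) - of_bool (n \<notin> c) else 0::real)"
    for c k
  \<comment> \<open>The leading \<open>0 +\<close> matches the constant term \<open>b i\<close> of
    \<open>f\<close>.\<close>
  have val: "0 + (\<Sum>k<n - 1. of_bool (Suc k = i) * P c k) = of_bool (i \<notin> c) - of_bool (n \<notin> c)"
    if "i \<in> {1..n}" for i c
  proof (cases "i = n")
    case True
    then show ?thesis by (auto intro!: sum.neutral)
  next
    case False
    have "(\<Sum>k<n - 1. of_bool (Suc k = i) * P c k) = (\<Sum>k\<in>{i - 1}. of_bool (Suc k = i) * P c k)"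
      using that False by (intro sum.mono_neutral_right) auto
    also have "\<dots> = P c (i - 1)"
      using that by simp
    also have "\<dots> = of_bool (i \<notin> c) - of_bool (n \<notin> c)"
    proof -
      have "i - 1 < n - 1" "Suc (i - 1) = i" using that False by auto
      then show ?thesis by (simp only: P_def if_True)
    qed
    finally show ?thesis by (simp only: add_0)
  qed
  have "c \<subseteq> {1..n}" if "c \<in> C" for c
    using assms(2) that by (auto simp: is_code_def)
  then have sub: "i \<in> {1..n}" if "c \<in> C" "i \<in> c" for c i
    using that by blast
  show ?thesis
  proof (rule closed_convex_realizable_of_minimizers[where b = "\<lambda>_. 0" and P = P
        and a = "\<lambda>i k. of_bool (Suc k = i)", OF assms(2,3)])
    show "0 < n - 1" using assms(1) by simp
    show "P c k = 0" if "n - 1 \<le> k" for c k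
      using that by (simp add: P_def)
  next
    fix c i j assume "c \<in> C" "i \<in> c" "j \<in> c"
    then show "0 + (\<Sum>k<n - 1. of_bool (Suc k = i) * P c k)
        = 0 + (\<Sum>k<n - 1. of_bool (Suc k = j) * P c k)"
      using val sub by simp
  next
    fix c i j assume "c \<in> C" "i \<in> c" "j \<in> {1..n}" "j \<notin> c"
    then show "0 + (\<Sum>k<n - 1. of_bool (Suc k = i) * P c k)
        < 0 + (\<Sum>k<n - 1. of_bool (Suc k = j) * P c k)"
      using val sub by simp
  qed
qed

text \<open>Squared factors make \<open>p c\<close> nonnegative, and a common degree makes the
  leading term at \<open>i\<close> independent of \<open>c\<close>, so it can serve as
  \<open>b i\<close>. The coordinates are the coefficients of degrees 1 to
  \<open>2 * m - 1\<close>.\<close>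

lemma closed_convex_realizable_card:
  assumes "is_code n C" "intersection_complete C" "0 < m" "\<And>c. c \<in> C \<Longrightarrow> card c \<le> m"
  shows "closed_convex_realizable n C (2 * m - 1)"
proof -
  define p :: "nat set \<Rightarrow> real poly"
    where "p c = (\<Prod>j\<in>c. [:- real j, 1:] ^ 2) * [:0, 1:] ^ (2 * (m - card c))" for c
    \<comment> \<open>the power of \<open>X\<close> pads the degree and has its root outside \<open>{1..n}\<close>\<close>
  define P where "P c k = (if k < 2 * m - 1 then coeff (p c) (Suc k) else 0)" for c k
  have sub: "c \<subseteq> {1..n}" "finite c" if "c \<in> C" for c
  proof -
    show "c \<subseteq> {1..n}" using assms(1) that by (auto simp: is_code_def)
    then show "finite c" by (rule finite_subset) simp
  qed
  have deg: "degree (p c) = 2 * m" and lead: "lead_coeff (p c) = 1" if "c \<in> C" for c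
  proof -
    have "degree (\<Prod>j\<in>c. [:- real j, 1:] ^ 2) = 2 * card c"
      by (subst degree_prod_eq_sum_degree) (auto simp: degree_power_eq)
    then show "degree (p c) = 2 * m"
      unfolding p_def using assms(4)[OF that]
      by (subst degree_mult_eq) (auto simp: degree_power_eq sub[OF that])
    show "lead_coeff (p c) = 1"
      by (simp add: p_def lead_coeff_mult lead_coeff_prod lead_coeff_power)
  qed
  \<comment> \<open>The dropped constant coefficient shifts all values by an amount independent of
    \<open>i\<close>, so comparisons between neurons survive.\<close>
  have val: "real i ^ (2 * m) + (\<Sum>k<2 * m - 1. real i ^ Suc k * P c k)
      = poly (p c) (real i) - coeff (p c) 0" if "c \<in> C" for c i
  proof -
    obtain M where M: "2 * m = Suc M" using assms(3) by (cases "2 * m") auto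
    have "poly (p c) (real i) = (\<Sum>k\<le>Suc M. coeff (p c) k * real i ^ k)"
      by (simp add: poly_altdef deg[OF that] M)
    also have "\<dots> = coeff (p c) 0 + (\<Sum>k<M. coeff (p c) (Suc k) * real i ^ Suc k) + real i ^ Suc M"
      using lead[OF that] unfolding lessThan_Suc_atMost[symmetric] sum.lessThan_Suc[of _ "Suc M"]
        sum.lessThan_Suc_shift[of _ M]
      by (simp add: deg[OF that] M)
    finally show ?thesis
      unfolding M P_def diff_Suc_1 by (simp add: mult.commute)
  qed
  have zero: "poly (p c) (real i) = 0" if "c \<in> C" "i \<in> c" for c i
    using that sub by (auto simp: p_def poly_prod)
  have pos: "0 < poly (p c) (real i)" if "c \<in> C" "i \<in> {1..n}" "i \<notin> c" for c i
    using that by (auto simp: p_def poly_prod intro!: mult_pos_pos prod_pos)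
  show ?thesis
  proof (rule closed_convex_realizable_of_minimizers[where b = "\<lambda>i. real i ^ (2 * m)" and P = P
        and a = "\<lambda>i k. real i ^ Suc k", OF assms(1,2)])
    show "0 < 2 * m - 1" using assms(3) by simp
    show "P c k = 0" if "2 * m - 1 \<le> k" for c k
      using that by (simp add: P_def)
  qed (simp_all only: val zero, intro diff_strict_right_mono pos)
qed

text \<open>The complex lies in the subset-closed family \<open>Pow {1..n}\<close>, so it is finite
  and its \<open>Max\<close> is genuine.\<close>

lemma card_le_complex_dim:
  assumes "is_code n C" "c \<in> C"
  shows "int (card c) \<le> complex_dim (simplicial_complex_of C) + 1"
proof -
  have "simplicial_complex_of C \<subseteq> Pow {1..n}"
    unfolding simplicial_complex_of_def using assms(1)
    by (intro Inter_lower) (auto simp: is_code_def subset_closed_def)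
  then have "finite (simplicial_complex_of C)"
    by (rule finite_subset) simp
  moreover have "c \<in> simplicial_complex_of C"
    using assms(2) by (auto simp: simplicial_complex_of_def)
  ultimately show ?thesis
    by (simp add: complex_dim_def)
qed

theorem theorem1p7:
  fixes n :: nat and C :: "nat set set" and d :: int
  assumes "2 \<le> n"
    and "is_code n C"
    and "C \<noteq> {{}}"
    and "intersection_complete C"
    and "d = complex_dim (simplicial_complex_of C)"
  shows "ereal_of_enat (cdim n C) \<le> ereal (real_of_int (min (2 * d + 1) (int n - 1)))"
proof -
  have card: "int (card c) \<le> d + 1" if "c \<in> C" for c
    using card_le_complex_dim[OF assms(2) that] assms(5) by simp
  obtain c where c: "c \<in> C" "c \<noteq> {}"
    using assms(2,3) by (auto simp: is_code_def)
  moreover have "finite c"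
    using assms(2) c(1) by (auto simp: is_code_def intro: finite_subset)
  ultimately have "0 < card c"
    by (simp add: card_gt_0_iff)
  \<comment> \<open>This makes \<open>nat (d + 1)\<close> positive and the truncated subtraction in
    \<open>2 * nat (d + 1) - 1\<close> exact.\<close>
  then have d: "0 \<le> d"
    using card[OF c(1)] by linarith
  have bound: "ereal_of_enat (cdim n C) \<le> ereal (real D)" if "closed_convex_realizable n C D" for D
  proof -
    have "cdim n C \<le> enat D"
      unfolding cdim_def using that by (intro Inf_lower) auto
    then have "ereal_of_enat (cdim n C) \<le> ereal_of_enat (enat D)"
      by (simp only: ereal_of_enat_le_iff)
    then show ?thesis by simp
  qed
  have "ereal_of_enat (cdim n C) \<le> ereal (real (2 * nat (d + 1) - 1))"
    using card d by (intro bound closed_convex_realizable_card[OF assms(2,4)]) (auto simp: le_nat_iff)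
  moreover have "real (2 * nat (d + 1) - 1) = real_of_int (2 * d + 1)"
    using d by (simp add: of_nat_diff)
  moreover have "ereal_of_enat (cdim n C) \<le> ereal (real (n - 1))"
    by (intro bound closed_convex_realizable_pred assms)
  moreover have "real (n - 1) = real_of_int (int n - 1)"
    using assms(1) by (simp add: of_nat_diff)
  ultimately show ?thesis
    unfolding min_def by metis
qed

end
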